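(* Let $(a_n)_{n\ge 0}$, $(b_n)_{n\ge 0}$, $(c_n)_{n\ge 0}$ be sequences of complex numbers with $b_0=1$, $a_n\ne 0$ and $c_n\ne 0$ for all $n\ge 0$. Let $\mathscr{A}$ be the infinite lower triangular matrix with entries $\mathscr{A}_{n,k}=a_kb_{n-k}c_n$ for $n\ge k\ge 0$ (and $0$ for $k>n$). Then for every integer $j\ge 1$, the matrix $\mathscr{A}_{[j]}$ belongs to $SDR_\infty$.
   Context: All matrices are infinite lower triangular matrices $\mathscr{A}=(A_{n,k})_{n\ge k\ge 0}$ with complex entries; we set $A_{n,k}=0$ whenever $k>n$. For an integer $m\ge 3$, $\mathscr{A}$ is called an SDR-matrix of order $m$ (written $\mathscr{A}\in SDR_m$) if for all integers $n,k\ge 0$, all $2\le p\le m-1$ and all $0\le r\le p-1$, $$\prod_{i=0}^{r}A_{n+i,k+r-i}\prod_{i=0}^{p-r-1}A_{n+p-i,k+r+i+1}=\prod_{i=0}^{r}A_{n+p-i,k+p-r+i}\prod_{i=0}^{p-r-1}A_{n+i,k+p-r-i-1}.$$ $SDR_\infty$ denotes the set of matrices lying in $SDR_m$ for every $m\ge 3$. For an integer $j\ge 1$, $\mathscr{A}_{[j]}=(A^{[j]}_{n,k})_{n\ge k\ge 0}$ is the lower triangular matrix with $A^{[j]}_{n,k}=\det\big(A_{n+s,k+t}\big)_{0\le s,t\le j-1}$ for $n\ge k\ge 0$ (the $j\times j$ determinant of the block with rows $n,\dots,n+j-1$ and columns $k,\dots,k+j-1$, using $A_{n,k}=0$ for $k>n$).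 *)

theory Defs
  imports Complex_Main "Jordan_Normal_Form.Determinant"
begin

text \<open>An infinite matrix is a total function of its row and column index; the convention that
  entries strictly above the diagonal vanish is the predicate below.\<close>

definition lower_triangular :: "(nat \<Rightarrow> nat \<Rightarrow> complex) \<Rightarrow> bool" where
  "lower_triangular A \<longleftrightarrow> (\<forall>n k. n < k \<longrightarrow> A n k = 0)"

text \<open>No subtraction of natural numbers below is truncated: \<open>r \<le> p - 1\<close> with \<open>p \<ge> 2\<close>, and the
  products range over \<open>i \<le> r\<close> and \<open>i \<le> p - r - 1\<close>. The order \<open>m\<close> is meant to be at least \<open>3\<close>.\<close>

definition SDR :: "nat \<Rightarrow> (nat \<Rightarrow> nat \<Rightarrow> complex) set" where
  "SDR m = {A. lower_triangular A \<and>
     (\<forall>n k p r. 2 \<le> p \<and> p \<le> m - 1 \<and> r \<le> p - 1 \<longrightarrow>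
        (\<Prod>i=0..r. A (n + i) (k + r - i)) *
        (\<Prod>i=0..p - r - 1. A (n + p - i) (k + r + i + 1)) =
        (\<Prod>i=0..r. A (n + p - i) (k + p - r + i)) *
        (\<Prod>i=0..p - r - 1. A (n + i) (k + p - r - i - 1)))}"

definition SDR_inf :: "(nat \<Rightarrow> nat \<Rightarrow> complex) set" where
  "SDR_inf = (\<Inter>m\<in>{3..}. SDR m)"

definition minor_matrix :: "(nat \<Rightarrow> nat \<Rightarrow> complex) \<Rightarrow> nat \<Rightarrow> nat \<Rightarrow> nat \<Rightarrow> complex" where
  "minor_matrix A j n k =
     (if k \<le> n then det (mat j j (\<lambda>(s, t). A (n + s) (k + t))) else 0)"

end

theory Submission
  imports Defs
begin

text \<open>Every matrix with entries \<open>x k * e (n - k) * y n\<close>, for \<open>e\<close> defined on all integers, satisfies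
  the product identities of \<open>SDR\<close>: on both sides the rows run through \<open>n, \<dots>, n + p\<close> once, the columns
  through \<open>k, \<dots>, k + p\<close> once, and the differences of row and column index agree factor by factor
  after reversing the order of the products. The minors of \<open>A\<close> are again of this form, since
  the factors \<open>a\<close> and \<open>c\<close> come out of the columns and rows of the determinant and leave a
  Toeplitz determinant.\<close>

lemma prod_shift_up:
  fixes f :: "nat \<Rightarrow> 'a::comm_monoid_mult"
  shows "(\<Prod>i=0..r. f (m + i)) = prod f {m..m + r}"
  by (rule prod.reindex_bij_witness[where i = "\<lambda>l. l - m" and j = "\<lambda>i. m + i"]) auto

lemma prod_shift_down:
  fixes f :: "nat \<Rightarrow> 'a::comm_monoid_mult"
  assumes "r \<le> m"
  shows "(\<Prod>i=0..r. f (m - i)) = prod f {m - r..m}"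
  by (rule prod.reindex_bij_witness[where i = "\<lambda>l. m - l" and j = "\<lambda>i. m - i"]) (use assms in auto)

lemma prod_split_interval:
  fixes f :: "nat \<Rightarrow> 'a::comm_monoid_mult"
  assumes "q < p"
  shows "prod f {m..m + q} * prod f {Suc (m + q)..m + p} = prod f {m..m + p}"
proof -
  have "{m..m + p} = {m..m + q} \<union> {Suc (m + q)..m + p}"
    using assms by auto
  then show ?thesis
    by (simp add: prod.union_disjoint)
qed

lemma prod_reverse:
  fixes f :: "nat \<Rightarrow> 'a::comm_monoid_mult"
  shows "(\<Prod>i=0..r. f i) = (\<Prod>i=0..r. f (r - i))"
  by (rule prod.reindex_bij_witness[where i = "\<lambda>l. r - l" and j = "\<lambda>i. r - i"]) auto

lemma scaled_toeplitz_SDR_identity: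
  fixes x y :: "nat \<Rightarrow> 'a::comm_ring_1" and e :: "int \<Rightarrow> 'a"
  assumes B: "\<And>n k. B n k = x k * e (int n - int k) * y n"
    and r: "r < p"
  shows "(\<Prod>i=0..r. B (n + i) (k + r - i)) * (\<Prod>i=0..p - r - 1. B (n + p - i) (k + r + i + 1)) =
    (\<Prod>i=0..r. B (n + p - i) (k + p - r + i)) * (\<Prod>i=0..p - r - 1. B (n + i) (k + p - r - i - 1))"
proof -
  \<comment> \<open>The second and fourth products run up to \<open>q\<close>. Writing
    \<open>p = r + q + 1\<close> clears the natural-number subtractions from the index computations
    below.\<close>
  define q where "q = p - r - 1"
  have p: "p = r + q + 1"
    using r by (simp add: q_def)
  \<comment> \<open>\<open>E1\<close> and \<open>E2\<close> collect the values of \<open>e\<close>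
    at the row-column differences. The first and third products share \<open>E1\<close>, the second
    and fourth share \<open>E2\<close>; in the third and fourth the differences come in the opposite
    order, hence \<open>prod_reverse\<close> there.\<close>
  define E1 where "E1 = (\<Prod>i=0..r. e (int n - int k - int r + 2 * int i))"
  define E2 where "E2 = (\<Prod>i=0..q. e (int n - int k + int q - 2 * int i))"
  have 1: "(\<Prod>i=0..r. B (n + i) (k + r - i)) = prod x {k..k + r} * E1 * prod y {n..n + r}"
  proof -
    have "(\<Prod>i=0..r. e (int (n + i) - int (k + r - i))) = E1"
      unfolding E1_def by (intro prod.cong refl arg_cong[of _ _ e]) auto
    then show ?thesis
      by (simp add: B prod.distrib prod_shift_up prod_shift_down[of r "k + r" x])
  qed
  have 2: "(\<Prod>i=0..q. B (n + p - i) (k + r + i + 1)) =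
      prod x {Suc (k + r)..k + p} * E2 * prod y {Suc (n + r)..n + p}"
  proof -
    have "(\<Prod>i=0..q. e (int (n + p - i) - int (k + r + i + 1))) = E2"
      unfolding E2_def by (intro prod.cong refl arg_cong[of _ _ e]) (auto simp: p)
    moreover have "(\<Prod>i=0..q. x (k + r + i + 1)) = prod x {Suc (k + r)..k + p}"
      using prod_shift_up[of x "Suc (k + r)" q] by (simp add: p ac_simps)
    moreover have "(\<Prod>i=0..q. y (n + p - i)) = prod y {Suc (n + r)..n + p}"
      using prod_shift_down[of q "n + p" y] by (simp add: p ac_simps)
    ultimately show ?thesis
      by (simp only: B prod.distrib)
  qed
  have 3: "(\<Prod>i=0..r. B (n + p - i) (k + p - r + i)) =
      prod x {Suc (k + q)..k + p} * E1 * prod y {Suc (n + q)..n + p}"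
  proof -
    have "(\<Prod>i=0..r. e (int (n + p - i) - int (k + p - r + i))) = E1"
      unfolding E1_def
      by (subst prod_reverse, intro prod.cong refl arg_cong[of _ _ e]) (auto simp: p)
    moreover have "(\<Prod>i=0..r. x (k + p - r + i)) = prod x {Suc (k + q)..k + p}"
      using prod_shift_up[of x "Suc (k + q)" r] by (simp add: p ac_simps)
    moreover have "(\<Prod>i=0..r. y (n + p - i)) = prod y {Suc (n + q)..n + p}"
      using prod_shift_down[of r "n + p" y] by (simp add: p ac_simps)
    ultimately show ?thesis
      by (simp only: B prod.distrib)
  qed
  have 4: "(\<Prod>i=0..q. B (n + i) (k + p - r - i - 1)) =
      prod x {k..k + q} * E2 * prod y {n..n + q}"
  proof -
    have "(\<Prod>i=0..q. e (int (n + i) - int (k + p - r - i - 1))) = E2"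
      unfolding E2_def
      by (subst prod_reverse, intro prod.cong refl arg_cong[of _ _ e]) (auto simp: p)
    moreover have "(\<Prod>i=0..q. x (k + p - r - i - 1)) = prod x {k..k + q}"
      using prod_shift_down[of q "k + q" x] by (simp add: p)
    ultimately show ?thesis
      by (simp only: B prod.distrib prod_shift_up)
  qed
  \<comment> \<open>Cutting \<open>{m..m + p}\<close> after \<open>m + r\<close> or after
    \<open>m + q\<close> gives the same total product; both cuts are legitimate since
    \<open>r\<close> and \<open>q\<close> are less than \<open>p\<close>.\<close>
  have split: "prod f {m..m + r} * prod f {Suc (m + r)..m + p} =
      prod f {m..m + q} * prod f {Suc (m + q)..m + p}" for f :: "nat \<Rightarrow> 'a" and m
    using r prod_split_interval[of r p f m] prod_split_interval[of q p f m] by (simp add: q_def)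
  have "(\<Prod>i=0..r. B (n + i) (k + r - i)) * (\<Prod>i=0..q. B (n + p - i) (k + r + i + 1)) =
      (prod x {k..k + r} * prod x {Suc (k + r)..k + p}) * (E1 * E2) *
      (prod y {n..n + r} * prod y {Suc (n + r)..n + p})"
    unfolding 1 2 by (simp only: ac_simps)
  also have "\<dots> = (\<Prod>i=0..r. B (n + p - i) (k + p - r + i)) *
      (\<Prod>i=0..q. B (n + i) (k + p - r - i - 1))"
    unfolding split 3 4 by (simp only: ac_simps)
  finally show ?thesis
    unfolding q_def .
qed

text \<open>In the Leibniz formula every permutation meets each row and each column exactly once, so
  all terms carry the same scalar factor.\<close>

lemma det_scale_rows_cols:
  fixes M :: "nat \<Rightarrow> nat \<Rightarrow> 'a::comm_ring_1"
  shows "det (mat j j (\<lambda>(s, t). x t * M s t * y s)) =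
    (\<Prod>t<j. x t) * det (mat j j (\<lambda>(s, t). M s t)) * (\<Prod>s<j. y s)"
proof -
  have "(\<Prod>i=0..<j. mat j j (\<lambda>(s, t). x t * M s t * y s) $$ (i, \<pi> i)) =
      (\<Prod>t<j. x t) * (\<Prod>i=0..<j. mat j j (\<lambda>(s, t). M s t) $$ (i, \<pi> i)) * (\<Prod>s<j. y s)"
    if "\<pi> permutes {0..<j}" for \<pi>
  proof -
    have "\<pi> i < j" if "i < j" for i
      using permutes_in_image[OF \<open>\<pi> permutes {0..<j}\<close>, of i] that by simp
    moreover have "(\<Prod>i=0..<j. x (\<pi> i)) = (\<Prod>t=0..<j. x t)"
      using prod.permute[OF that, of x] by (simp add: comp_def)
    ultimately show ?thesis
      by (simp add: prod.distrib atLeast0LessThan)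
  qed
  then show ?thesis
    by (simp add: det_def sum_distrib_left sum_distrib_right ac_simps)
qed

theorem theorem2p4:
  fixes a b c :: "nat \<Rightarrow> complex" and A :: "nat \<Rightarrow> nat \<Rightarrow> complex" and j :: nat
  assumes "b 0 = 1"
    and "\<And>n. a n \<noteq> 0"
    and "\<And>n. c n \<noteq> 0"
    and "\<And>n k. A n k = (if k \<le> n then a k * b (n - k) * c n else 0)"
    and "j \<ge> 1"
  shows "minor_matrix A j \<in> SDR_inf"
proof -
  \<comment> \<open>Extending \<open>b\<close> by zero to negative integers absorbs the zeros of
    \<open>A\<close> above the diagonal, so blocks crossing the diagonal need no case distinction.
    The cutoff in \<open>e\<close> mirrors the zeros that \<open>minor_matrix\<close> has for
    \<open>n < k\<close>.\<close>
  define u where "u d = (if d \<ge> 0 then b (nat d) else 0)" for d :: int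
  define e where "e d = (if d \<ge> 0 then det (mat j j (\<lambda>(s, t). u (d + int s - int t))) else 0)"
    for d :: int
  have "minor_matrix A j n k = (\<Prod>t<j. a (k + t)) * e (int n - int k) * (\<Prod>s<j. c (n + s))"
    for n k
  proof (cases "k \<le> n")
    case True
    have "A (n + s) (k + t) = a (k + t) * u (int n - int k + int s - int t) * c (n + s)" for s t
      by (auto simp: assms(4) u_def intro!: arg_cong[of _ _ b])
    then show ?thesis
      using True by (simp add: minor_matrix_def e_def det_scale_rows_cols)
  qed (simp add: minor_matrix_def e_def)
  then have SDR_identity: "(\<Prod>i=0..r. minor_matrix A j (n + i) (k + r - i)) *
        (\<Prod>i=0..p - r - 1. minor_matrix A j (n + p - i) (k + r + i + 1)) =
        (\<Prod>i=0..r. minor_matrix A j (n + p - i) (k + p - r + i)) *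
        (\<Prod>i=0..p - r - 1. minor_matrix A j (n + i) (k + p - r - i - 1))"
    if "r < p" for n k p r
    using that by (rule scaled_toeplitz_SDR_identity)
  show ?thesis
    unfolding SDR_inf_def SDR_def
  proof (intro INT_I CollectI conjI allI impI SDR_identity)
    show "lower_triangular (minor_matrix A j)"
      by (simp add: lower_triangular_def minor_matrix_def)
  \<comment> \<open>What remains is \<open>r < p\<close>; it follows from
    \<open>r \<le> p - 1\<close> because \<open>2 \<le> p\<close> keeps the subtraction from
    truncating.\<close>
  qed linarith
qed

end
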